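(* Let $K\in End^*_{\mathcal A}(\mathcal H)$ and $C,C'\in GL^+(\mathcal H)$ with $CC'=C'C$. Let $\{W_i\}_{i\in I}$ be closed orthogonally complemented submodules and $\{w_i\}$ weights such that $Sf=\sum_{i\in I}w_i^2\pi_{W_i}f$ converges for all $f$, and suppose $K$ and $S$ commute with $C$ and with $C'$. Then $\{W_i,w_i\}_{i\in I}$ is a $*$-$K$-fusion frame for $\mathcal H$ if and only if it is a $(C,C')$-controlled $*$-$K$-fusion frame for $\mathcal H$.
   Context: $\mathcal A$ unital C*-algebra, $\mathcal H$ Hilbert $\mathcal A$-module; $End^*_{\mathcal A}(\mathcal H)$ adjointable operators; $GL^+(\mathcal H)$ positive invertible adjointable operators with bounded inverse; $\pi_W$ orthogonal projection onto closed orthogonally complemented submodule $W$; weight = positive invertible element of the center of $\mathcal A$; $a\in\mathcal A$ strictly nonzero if $0\notin\sigma(a)$. $\{W_i,w_i\}$ is a $(C,C')$-controlled $*$-$K$-fusion frame if $\sum_iw_i^2\langle\pi_{W_i}Cf,\pi_{W_i}C'f\rangle$ converges in norm and there are strictly nonzero $A,B\in\mathcal A$ with $A\langle K^*f,K^*f\rangle A^*\le\sum_iw_i^2\langle\pi_{W_i}Cf,\pi_{W_i}C'f\rangle\le B\langle f,f\rangle B^*$ for all $f$; a $*$-$K$-fusion frame is the case $C=C'=\mathrm{Id}$. *)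

theory Defs
  imports "HOL-Analysis.Analysis"
begin

text \<open>A unital complex C*-algebra, presented as a real Banach algebra with unit
(norm 1 = 1) equipped with a central imaginary unit (giving the complex structure),
an involution and the C*-identity.\<close>

class cstar_ops = real_normed_algebra_1 + banach +
  fixes cstar :: "'a \<Rightarrow> 'a"
    and imag :: 'a

class cstar_algebra = cstar_ops +
  assumes cstar_add: "cstar (x + y) = cstar x + cstar y"
    and cstar_mult: "cstar (x * y) = cstar y * cstar x"
    and cstar_cstar: "cstar (cstar x) = x"
    and cstar_scaleR: "cstar (scaleR r x) = scaleR r (cstar x)"
    and imag_sq: "imag * imag = - 1"
    and imag_central: "imag * x = x * imag"
    and cstar_imag: "cstar imag = - imag"
    and norm_cscale: "norm (scaleR a x + scaleR b (imag * x)) = cmod (Complex a b) * norm x"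
    and cstar_identity: "norm (cstar x * x) = norm x ^ 2"

definition cscale :: "complex \<Rightarrow> 'a::cstar_algebra \<Rightarrow> 'a" where
  "cscale z x = scaleR (Re z) x + scaleR (Im z) (imag * x)"

definition ca_invertible :: "'a::cstar_algebra \<Rightarrow> bool" where
  "ca_invertible a \<longleftrightarrow> (\<exists>b. a * b = 1 \<and> b * a = 1)"

definition ca_spectrum :: "'a::cstar_algebra \<Rightarrow> complex set" where
  "ca_spectrum a = {z. \<not> ca_invertible (a - cscale z 1)}"

definition strictly_nonzero :: "'a::cstar_algebra \<Rightarrow> bool" where
  "strictly_nonzero a \<longleftrightarrow> 0 \<notin> ca_spectrum a"

definition ca_pos :: "'a::cstar_algebra \<Rightarrow> bool" where
  "ca_pos a \<longleftrightarrow> (\<exists>b. a = cstar b * b)"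

definition ca_le :: "'a::cstar_algebra \<Rightarrow> 'a \<Rightarrow> bool" where
  "ca_le a b \<longleftrightarrow> ca_pos (b - a)"

definition weight :: "'a::cstar_algebra \<Rightarrow> bool" where
  "weight w \<longleftrightarrow> (\<forall>x. w * x = x * w) \<and> ca_pos w \<and> ca_invertible w"

text \<open>A (left) Hilbert module over the C*-algebra 'a: the carrier type 'h is a real
Banach space whose norm is the one induced by the 'a-valued inner product
(completeness comes from the class banach); act is the module action.\<close>

definition hilbert_module ::
  "('a::cstar_algebra \<Rightarrow> 'h::banach \<Rightarrow> 'h) \<Rightarrow> ('h \<Rightarrow> 'h \<Rightarrow> 'a) \<Rightarrow> bool" where
  "hilbert_module act ip \<longleftrightarrow>
     (\<forall>a f g. act a (f + g) = act a f + act a g) \<and>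
     (\<forall>a b f. act (a + b) f = act a f + act b f) \<and>
     (\<forall>a b f. act (a * b) f = act a (act b f)) \<and>
     (\<forall>f. act 1 f = f) \<and>
     (\<forall>r f. act (of_real r) f = scaleR r f) \<and>
     (\<forall>f g h. ip (f + g) h = ip f h + ip g h) \<and>
     (\<forall>a f g. ip (act a f) g = a * ip f g) \<and>
     (\<forall>f g. ip g f = cstar (ip f g)) \<and>
     (\<forall>f. ca_pos (ip f f)) \<and>
     (\<forall>f. ip f f = 0 \<longrightarrow> f = 0) \<and>
     (\<forall>f. norm f = sqrt (norm (ip f f)))"

definition adjointable :: "('h \<Rightarrow> 'h \<Rightarrow> 'a) \<Rightarrow> ('h \<Rightarrow> 'h) \<Rightarrow> bool" where
  "adjointable ip T \<longleftrightarrow> (\<exists>T'. \<forall>f g. ip (T f) g = ip f (T' g))"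

definition adjoint :: "('h \<Rightarrow> 'h \<Rightarrow> 'a) \<Rightarrow> ('h \<Rightarrow> 'h) \<Rightarrow> 'h \<Rightarrow> 'h" where
  "adjoint ip T = (SOME T'. \<forall>f g. ip (T f) g = ip f (T' g))"

text \<open>GL^+(H): positive invertible adjointable operators with (adjointable, hence
bounded) inverse\<close>
definition GLplus :: "('h \<Rightarrow> 'h \<Rightarrow> 'a::cstar_algebra) \<Rightarrow> ('h \<Rightarrow> 'h) \<Rightarrow> bool" where
  "GLplus ip T \<longleftrightarrow> adjointable ip T \<and> (\<forall>f. ca_pos (ip (T f) f)) \<and>
     (\<exists>T'. adjointable ip T' \<and> T \<circ> T' = id \<and> T' \<circ> T = id)"

definition orth_compl_submodule ::
  "('a::cstar_algebra \<Rightarrow> 'h::banach \<Rightarrow> 'h) \<Rightarrow> ('h \<Rightarrow> 'h \<Rightarrow> 'a) \<Rightarrow> 'h set \<Rightarrow> bool" where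
  "orth_compl_submodule act ip W \<longleftrightarrow>
     0 \<in> W \<and> (\<forall>f\<in>W. \<forall>g\<in>W. f + g \<in> W) \<and> (\<forall>a. \<forall>f\<in>W. act a f \<in> W) \<and>
     closed W \<and>
     (\<forall>f. \<exists>u\<in>W. \<exists>v. f = u + v \<and> (\<forall>x\<in>W. ip v x = 0))"

definition orth_proj :: "('h::ab_group_add \<Rightarrow> 'h \<Rightarrow> 'a::zero) \<Rightarrow> 'h set \<Rightarrow> 'h \<Rightarrow> 'h" where
  "orth_proj ip W f = (THE u. u \<in> W \<and> (\<forall>x\<in>W. ip (f - u) x = 0))"

definition controlled_star_K_fusion_frame ::
  "('h::banach \<Rightarrow> 'h \<Rightarrow> 'a::cstar_algebra) \<Rightarrow> ('h \<Rightarrow> 'h) \<Rightarrow> ('h \<Rightarrow> 'h) \<Rightarrow> ('h \<Rightarrow> 'h)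
     \<Rightarrow> 'i set \<Rightarrow> ('i \<Rightarrow> 'h set) \<Rightarrow> ('i \<Rightarrow> 'a) \<Rightarrow> bool" where
  "controlled_star_K_fusion_frame ip K C C' I W w \<longleftrightarrow>
     (\<forall>f. (\<lambda>i. w i * w i * ip (orth_proj ip (W i) (C f)) (orth_proj ip (W i) (C' f)))
            summable_on I) \<and>
     (\<exists>A B. strictly_nonzero A \<and> strictly_nonzero B \<and>
        (\<forall>f. ca_le (A * ip (adjoint ip K f) (adjoint ip K f) * cstar A)
                (\<Sum>\<^sub>\<infinity>i\<in>I. w i * w i * ip (orth_proj ip (W i) (C f)) (orth_proj ip (W i) (C' f))) \<and>
             ca_le (\<Sum>\<^sub>\<infinity>i\<in>I. w i * w i * ip (orth_proj ip (W i) (C f)) (orth_proj ip (W i) (C' f)))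
                (B * ip f f * cstar B)))"

definition star_K_fusion_frame ::
  "('h::banach \<Rightarrow> 'h \<Rightarrow> 'a::cstar_algebra) \<Rightarrow> ('h \<Rightarrow> 'h)
     \<Rightarrow> 'i set \<Rightarrow> ('i \<Rightarrow> 'h set) \<Rightarrow> ('i \<Rightarrow> 'a) \<Rightarrow> bool" where
  "star_K_fusion_frame ip K I W w \<longleftrightarrow> controlled_star_K_fusion_frame ip K id id I W w"

end

theory Submission
  imports Defs
begin

text \<open>
  Let \<open>R\<close> and \<open>R'\<close> be self-adjoint square roots of \<open>C\<close> and \<open>C'\<close> that commute with everything
  commuting with \<open>C\<close> and \<open>C'\<close>, and put \<open>V = R R'\<close>. Then the controlled sum is
  \<open>\<langle>S C f, C' f\<rangle> = \<langle>S V f, V f\<rangle>\<close>, i.e. the uncontrolled quadratic form evaluated at \<open>V f\<close>.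
  Since \<open>V\<close> is invertible and commutes with \<open>K\<^sup>*\<close>, the estimate \<open>\<langle>T f, T f\<rangle> \<le> M \<langle>f, f\<rangle>\<close> for
  adjointable \<open>T\<close>, applied to \<open>V\<close> and to its inverse, transports frame bounds in both directions.

  Everything is built on the power series of \<open>sqrt (1 - x)\<close>, whose coefficients are absolutely
  summable, so that it converges on all contractions. Applied to left multiplications it also
  replaces the continuous functional calculus in the proof that elements \<open>x\<^sup>*x\<close> of a C*-algebra
  form a convex cone.
\<close>

section \<open>The square root series of a contraction\<close>

text \<open>The Taylor coefficients of \<open>sqrt (1 - x)\<close> at 0.\<close>

definition sqc :: "nat \<Rightarrow> real" where
  "sqc n = ((1/2) gchoose n) * (-1) ^ n"

lemma sqc_0 [simp]: "sqc 0 = 1"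
  by (simp add: sqc_def)

lemma sqc_Suc: "sqc (Suc n) = sqc n * (real n - 1/2) / (real n + 1)"
proof -
  have "(1/2) * ((1/2::real) gchoose n) = real n * ((1/2) gchoose n) + real (Suc n) * ((1/2) gchoose (Suc n))"
    by (rule gbinomial_mult_1)
  then have "((1/2::real) gchoose (Suc n)) = ((1/2) gchoose n) * (1/2 - real n) / (real n + 1)"
    by (simp add: field_simps)
  then show ?thesis
    unfolding sqc_def by (simp add: algebra_simps)
qed

lemma sqc_Suc_nonpos: "sqc (Suc n) \<le> 0"
proof (induction n)
  case 0
  show ?case by (simp add: sqc_Suc)
next
  case (Suc n)
  have "sqc (Suc (Suc n)) = sqc (Suc n) * ((real (Suc n) - 1/2) / (real (Suc n) + 1))"
    by (subst sqc_Suc) simp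
  moreover have "(real (Suc n) - 1/2) / (real (Suc n) + 1) \<ge> 0" by simp
  ultimately show ?case using Suc by (simp only: mult_nonpos_nonneg)
qed

text \<open>This is \<open>sqrt (1 - x) * sqrt (1 - x) = 1 - x\<close> read coefficientwise:
  Vandermonde's convolution with 1/2 + 1/2 = 1.\<close>

lemma sqc_convolution:
  "(\<Sum>i\<le>n. sqc i * sqc (n - i)) = (if n = 0 then 1 else if n = 1 then -1 else 0)"
proof -
  have "(\<Sum>i\<le>n. sqc i * sqc (n - i)) = (\<Sum>i\<le>n. ((1/2) gchoose i) * ((1/2) gchoose (n - i)) * (-1) ^ n)"
  proof (rule sum.cong)
    fix i assume "i \<in> {..n}"
    then have "(-1::real) ^ n = (-1) ^ i * (-1) ^ (n - i)"
      by (simp flip: power_add)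
    then show "sqc i * sqc (n - i) = ((1/2) gchoose i) * ((1/2) gchoose (n - i)) * (-1) ^ n"
      by (simp add: sqc_def)
  qed simp
  also have "\<dots> = (1 gchoose n) * (-1) ^ n"
    using gbinomial_Vandermonde[of "1/2::real" "1/2" n]
    by (simp flip: sum_distrib_right add: atMost_atLeast0)
  also have "(1::real) gchoose n = real (1 choose n)"
    by (metis binomial_gbinomial of_nat_1)
  finally show ?thesis by (cases n) (auto simp: binomial_eq_0 not_less_eq_eq)
qed

text \<open>All coefficients after the first are nonpositive, so for 0 < x < 1 the sum weighted by
  powers of x is at most 1 - sqrt (1 - x), hence at most 1. In the finite sum x may then tend to
  1.\<close>

lemma sum_abs_sqc_Suc_le: "(\<Sum>n<N. \<bar>sqc (Suc n)\<bar>) \<le> 1"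
proof -
  have le: "(\<Sum>n<N. \<bar>sqc (Suc n)\<bar> * x ^ Suc n) \<le> 1" if x: "0 < x" "x < 1" for x :: real
  proof -
    have "(\<lambda>n. ((1/2) gchoose n) * (-x) ^ n) sums (1 + - x) powr (1/2)"
      using x by (intro gen_binomial_real) auto
    then have "(\<lambda>n. sqc n * x ^ n) sums (1 - x) powr (1/2)"
      by (simp add: sqc_def mult.assoc flip: power_mult_distrib)
    then have "(\<lambda>n. - (sqc (Suc n) * x ^ Suc n)) sums - ((1 - x) powr (1/2) - 1)"
      using sums_Suc_iff[of "\<lambda>n. sqc n * x ^ n"] by (intro sums_minus) simp
    then have *: "(\<lambda>n. \<bar>sqc (Suc n)\<bar> * x ^ Suc n) sums (1 - (1 - x) powr (1/2))"
      using sqc_Suc_nonpos by (simp add: abs_of_nonpos)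
    have "(\<Sum>n<N. \<bar>sqc (Suc n)\<bar> * x ^ Suc n) \<le> 1 - (1 - x) powr (1/2)"
      using x * by (metis (no_types, lifting) abs_ge_zero less_eq_real_def mult_nonneg_nonneg
          finite_lessThan sum_le_suminf sums_iff zero_le_power)
    also have "\<dots> \<le> 1" by simp
    finally show ?thesis .
  qed
  have "((\<lambda>x. \<Sum>n<N. \<bar>sqc (Suc n)\<bar> * x ^ Suc n) \<longlongrightarrow> (\<Sum>n<N. \<bar>sqc (Suc n)\<bar> * 1 ^ Suc n)) (at_left 1)"
    by (intro tendsto_intros)
  moreover have "eventually (\<lambda>x. (\<Sum>n<N. \<bar>sqc (Suc n)\<bar> * x ^ Suc n) \<le> 1) (at_left (1::real))"
    using eventually_at_left_real[of 0 "1::real"] by (auto elim!: eventually_mono intro!: le simp del: power_Suc)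
  ultimately have "(\<Sum>n<N. \<bar>sqc (Suc n)\<bar> * 1 ^ Suc n) \<le> 1"
    by (rule tendsto_upperbound) simp
  then show ?thesis by simp
qed

lemma sqc_tail_summable: "summable (\<lambda>n. \<bar>sqc (Suc n)\<bar>)"
  by (rule summableI_nonneg_bounded[OF _ sum_abs_sqc_Suc_le]) simp

lemma sqc_abs_summable_on: "(\<lambda>n. \<bar>sqc n\<bar>) summable_on UNIV"
  using sqc_tail_summable summable_Suc_iff[of "\<lambda>n. \<bar>sqc n\<bar>"]
  by (simp add: summable_on_UNIV_nonneg_real_iff)

section \<open>Square roots of operators by the series\<close>

definition contraction :: "('h::real_normed_vector \<Rightarrow> 'h) \<Rightarrow> bool" where
  "contraction X \<longleftrightarrow> bounded_linear X \<and> (\<forall>f. norm (X f) \<le> norm f)"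

text \<open>The square root of \<open>1 - X\<close>, not of \<open>X\<close>.\<close>

definition opsqrt :: "('h::banach \<Rightarrow> 'h) \<Rightarrow> 'h \<Rightarrow> 'h" where
  "opsqrt X f = (\<Sum>\<^sub>\<infinity>n. sqc n *\<^sub>R (X ^^ n) f)"

lemma contraction_funpow:
  assumes "contraction X"
  shows "bounded_linear (X ^^ n)" "norm ((X ^^ n) f) \<le> norm f"
proof -
  show "bounded_linear (X ^^ n)"
  proof (induction n)
    case 0
    then show ?case by (simp add: id_def bounded_linear_ident)
  next
    case (Suc n)
    then show ?case using assms bounded_linear_compose[of X "X ^^ n"]
      by (simp add: contraction_def o_def)
  qed
  show "norm ((X ^^ n) f) \<le> norm f"
    by (induction n) (use assms in \<open>auto simp: contraction_def intro: order_trans\<close>)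
qed

lemma opsqrt_abs_summable:
  assumes "contraction (X :: 'h::banach \<Rightarrow> 'h)"
  shows "(\<lambda>n. norm (sqc n *\<^sub>R (X ^^ n) f)) summable_on UNIV"
proof (rule Infinite_Sum.abs_summable_on_comparison_test')
  show "(\<lambda>n. \<bar>sqc n\<bar> * norm f) summable_on UNIV"
    by (intro summable_on_cmult_left sqc_abs_summable_on)
  show "norm (sqc n *\<^sub>R (X ^^ n) f) \<le> \<bar>sqc n\<bar> * norm f" for n
    using contraction_funpow(2)[OF assms, of n f] by (simp add: mult_left_mono)
qed

lemma opsqrt_has_sum:
  assumes "contraction (X :: 'h::banach \<Rightarrow> 'h)"
  shows "((\<lambda>n. sqc n *\<^sub>R (X ^^ n) f) has_sum opsqrt X f) UNIV"
  unfolding opsqrt_def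
  using abs_summable_summable[OF opsqrt_abs_summable[OF assms]] by (rule has_sum_infsum)

text \<open>The tail coefficients have l1-norm at most 1 and powers of X do not increase norms. The
  sharp constant 1 is what later makes \<open>asqrt x\<close> positive.\<close>

lemma norm_diff_opsqrt_le:
  assumes "contraction (X :: 'h::banach \<Rightarrow> 'h)"
  shows "norm (f - opsqrt X f) \<le> norm f"
proof -
  have "((\<lambda>n. sqc n *\<^sub>R (X ^^ n) f) has_sum opsqrt X f) UNIV"
    by (rule opsqrt_has_sum[OF assms])
  then have "(\<lambda>n. sqc n *\<^sub>R (X ^^ n) f) sums opsqrt X f" by (rule has_sum_imp_sums)
  then have *: "(\<lambda>n. sqc (Suc n) *\<^sub>R (X ^^ Suc n) f) sums (opsqrt X f - f)"
    by (subst sums_Suc_iff) simp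
  have s: "summable (\<lambda>n. \<bar>sqc (Suc n)\<bar> * norm f)"
    by (intro summable_mult2 sqc_tail_summable)
  have "norm (opsqrt X f - f) \<le> (\<Sum>n. \<bar>sqc (Suc n)\<bar> * norm f)"
    unfolding sums_unique[OF *]
  proof (rule norm_suminf_le[OF _ s])
    show "norm (sqc (Suc n) *\<^sub>R (X ^^ Suc n) f) \<le> \<bar>sqc (Suc n)\<bar> * norm f" for n
      using contraction_funpow(2)[OF assms, of "Suc n" f] by (simp add: mult_left_mono)
  qed
  also have "\<dots> = (\<Sum>n. \<bar>sqc (Suc n)\<bar>) * norm f"
    by (intro suminf_mult2[symmetric] sqc_tail_summable)
  also have "\<dots> \<le> 1 * norm f"
    by (intro mult_right_mono suminf_le_const[OF sqc_tail_summable sum_abs_sqc_Suc_le]) simp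
  finally show ?thesis by (simp add: norm_minus_commute)
qed

text \<open>A bounded T passes through the series termwise. Allowing X and Y to differ covers not
  only commutation but also \<open>cstar\<close>, which exchanges left and right
  multiplications.\<close>

lemma opsqrt_intertwine:
  assumes "contraction (X :: 'h::banach \<Rightarrow> 'h)" "contraction (Y :: 'k::banach \<Rightarrow> 'k)"
    and T: "bounded_linear T" "\<And>f. T (X f) = Y (T f)"
  shows "T (opsqrt X f) = opsqrt Y (T f)"
proof -
  have "T ((X ^^ n) f) = (Y ^^ n) (T f)" for n
    by (induction n) (auto simp: T(2))
  then have "((\<lambda>n. sqc n *\<^sub>R (Y ^^ n) (T f)) has_sum T (opsqrt X f)) UNIV"
    using has_sum_bounded_linear[OF T(1) opsqrt_has_sum[OF assms(1)], of f]
    by (simp add: linear_scale[OF bounded_linear.linear[OF T(1)]])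
  then show ?thesis
    using opsqrt_has_sum[OF assms(2)] has_sum_unique by blast
qed

lemma bounded_linear_opsqrt:
  assumes X: "contraction (X :: 'h::banach \<Rightarrow> 'h)"
  shows "bounded_linear (opsqrt X)"
proof (rule bounded_linear_intro[where K = 2])
  note lin = bounded_linear.linear[OF contraction_funpow(1)[OF X]]
  show "opsqrt X (f + g) = opsqrt X f + opsqrt X g" for f g
    using has_sum_add[OF opsqrt_has_sum[OF X, of f] opsqrt_has_sum[OF X, of g]]
      opsqrt_has_sum[OF X, of "f + g"] has_sum_unique
    by (fastforce simp: linear_add[OF lin] scaleR_add_right)
  show "opsqrt X (r *\<^sub>R f) = r *\<^sub>R opsqrt X f" for r f
    using opsqrt_intertwine[OF X X, of "\<lambda>f. r *\<^sub>R f" f] X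
    by (simp add: bounded_linear_scaleR_right contraction_def bounded_linear.linear linear_scale)
  show "norm (opsqrt X f) \<le> norm f * 2" for f
    using norm_diff_opsqrt_le[OF X, of f] norm_triangle_ineq2[of "opsqrt X f" f]
    by (simp add: norm_minus_commute)
qed

text \<open>A Cauchy product: absolute convergence permits summation along the diagonals n + m = k,
  where \<open>sqc_convolution\<close> leaves only k = 0 and k = 1.\<close>

lemma opsqrt_square:
  assumes X: "contraction (X :: 'h::banach \<Rightarrow> 'h)"
  shows "opsqrt X (opsqrt X f) = f - X f"
proof -
  let ?R = "opsqrt X" and ?F = "\<lambda>n m. (sqc n * sqc m) *\<^sub>R (X ^^ (n + m)) f"
  have inner: "((\<lambda>m. ?F n m) has_sum sqc n *\<^sub>R (X ^^ n) (?R f)) UNIV" for n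
  proof -
    have "bounded_linear (\<lambda>g. sqc n *\<^sub>R (X ^^ n) g)"
      using contraction_funpow(1)[OF X] by (simp add: bounded_linear_const_scaleR)
    from has_sum_bounded_linear[OF this opsqrt_has_sum[OF X, of f]]
    show ?thesis
      by (simp add: linear_scale[OF bounded_linear.linear[OF contraction_funpow(1)[OF X]]] funpow_add)
  qed
  have abs: "(\<lambda>x. norm (case x of (n, m) \<Rightarrow> ?F n m)) summable_on (UNIV \<times> UNIV)"
  proof (rule Infinite_Sum.abs_summable_on_comparison_test')
    have "(\<lambda>x. norm (case x of (n, m) \<Rightarrow> \<bar>sqc n\<bar> * \<bar>sqc m\<bar>)) summable_on (UNIV \<times> UNIV)"
      using sqc_abs_summable_on
      by (subst Infinite_Sum.abs_summable_on_Sigma_iff)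
        (auto simp: abs_mult infsum_cmult_right' intro!: summable_on_cmult_right summable_on_cmult_left)
    then show "(\<lambda>(n, m). \<bar>sqc n\<bar> * \<bar>sqc m\<bar> * norm f) summable_on (UNIV \<times> UNIV)"
      using summable_on_cmult_left[of "\<lambda>(n, m). \<bar>sqc n\<bar> * \<bar>sqc m\<bar>" _ "norm f"]
      by (simp add: case_prod_unfold abs_mult)
    show "norm (case x of (n, m) \<Rightarrow> ?F n m) \<le> (case x of (n, m) \<Rightarrow> \<bar>sqc n\<bar> * \<bar>sqc m\<bar> * norm f)" for x
      using contraction_funpow(2)[OF X] by (auto simp: abs_mult intro!: mult_left_mono split: prod.split)
  qed
  then have sum: "(\<lambda>(n, m). ?F n m) summable_on (UNIV \<times> UNIV)"
    by (rule abs_summable_summable)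
  have "?R (?R f) = (\<Sum>\<^sub>\<infinity>n. \<Sum>\<^sub>\<infinity>m. ?F n m)"
    unfolding opsqrt_def[of X "?R f"] using infsumI[OF inner] by simp
  also have "\<dots> = (\<Sum>\<^sub>\<infinity>(n, m)\<in>UNIV \<times> UNIV. ?F n m)"
    using infsum_Sigma_banach[OF sum] by simp
  also have "\<dots> = (\<Sum>\<^sub>\<infinity>(k, i)\<in>Sigma UNIV (\<lambda>k. {..k}). ?F i (k - i))"
  proof -
    have "bij_betw (\<lambda>(k, i). (i, k - i)) (Sigma UNIV (\<lambda>k. {..k})) (UNIV \<times> (UNIV :: nat set))"
      by (rule bij_betwI[where g = "\<lambda>(n, m). (n + m, n)"]) auto
    from infsum_reindex_bij_betw[OF this, of "\<lambda>(n, m). ?F n m"] show ?thesis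
      by (simp add: case_prod_unfold)
  qed
  also have "\<dots> = (\<Sum>\<^sub>\<infinity>k. \<Sum>\<^sub>\<infinity>i\<in>{..k}. ?F i (k - i))"
  proof -
    have "bij_betw (\<lambda>(k, i). (i, k - i)) (Sigma UNIV (\<lambda>k. {..k})) (UNIV \<times> (UNIV :: nat set))"
      by (rule bij_betwI[where g = "\<lambda>(n, m). (n + m, n)"]) auto
    from summable_on_reindex_bij_betw[OF this, of "\<lambda>(n, m). ?F n m"] sum
    have "(\<lambda>(k, i). ?F i (k - i)) summable_on (Sigma UNIV (\<lambda>k. {..k}))"
      by (simp add: case_prod_unfold)
    from infsum_Sigma_banach[OF this] show ?thesis by simp
  qed
  also have "\<dots> = (\<Sum>\<^sub>\<infinity>k. (\<Sum>i\<le>k. sqc i * sqc (k - i)) *\<^sub>R (X ^^ k) f)"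
    by (simp add: scaleR_sum_left)
  also have "\<dots> = (\<Sum>\<^sub>\<infinity>k\<in>{0, 1}. (\<Sum>i\<le>k. sqc i * sqc (k - i)) *\<^sub>R (X ^^ k) f)"
    by (rule infsum_cong_neutral) (auto simp: sqc_convolution)
  also have "\<dots> = f - X f"
    by (simp add: sqc_convolution)
  finally show ?thesis .
qed

section \<open>The positive cone of a C*-algebra\<close>

lemma cstar_0 [simp]: "cstar (0 :: 'a::cstar_algebra) = 0"
  using cstar_scaleR[of 0 "0 :: 'a"] by simp

lemma cstar_minus [simp]: "cstar (- x) = - cstar (x :: 'a::cstar_algebra)"
  using cstar_scaleR[of "-1" x] by simp

lemma cstar_diff [simp]: "cstar (x - y) = cstar x - cstar (y :: 'a::cstar_algebra)"
  using cstar_add[of x "- y"] by simp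

lemma cstar_1 [simp]: "cstar (1 :: 'a::cstar_algebra) = 1"
  using cstar_mult[of "cstar 1" "1 :: 'a"] cstar_cstar[of "1 :: 'a"] by simp

lemmas cstar_simps [simp] = cstar_add cstar_mult cstar_cstar cstar_scaleR cstar_imag

lemma norm_cstar [simp]: "norm (cstar x) = norm (x :: 'a::cstar_algebra)"
proof -
  have le: "norm y \<le> norm (cstar y)" for y :: 'a
  proof (cases "y = 0")
    case False
    have "norm y * norm y \<le> norm (cstar y) * norm y"
      using cstar_identity[of y] norm_mult_ineq[of "cstar y" y] by (simp add: power2_eq_square)
    then show ?thesis using False by simp
  qed simp
  from le[of x] le[of "cstar x"] show ?thesis by simp
qed

lemma bounded_linear_cstar: "bounded_linear (cstar :: 'a::cstar_algebra \<Rightarrow> 'a)"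
  by (rule bounded_linear_intro[where K = 1]) simp_all

lemma cstar_mult_self_eq_0: "cstar x * x = 0 \<Longrightarrow> x = (0 :: 'a::cstar_algebra)"
  using cstar_identity[of x] by simp

lemma selfadjoint_square_norm:
  "cstar x = (x :: 'a::cstar_algebra) \<Longrightarrow> norm (x * x) = norm x ^ 2"
  using cstar_identity[of x] by simp

lemma imag_left_commute: "x * (imag * y) = imag * (x * (y :: 'a::cstar_algebra))"
  by (metis imag_central mult.assoc)

lemma imag_imag [simp]: "imag * (imag * x) = - (x :: 'a::cstar_algebra)"
  by (simp add: imag_sq flip: mult.assoc)

text \<open>The analogue of |a + ib|^2 = a^2 + b^2; commutation cancels the cross terms.\<close>

lemma cstar_mult_real_imag:
  assumes "cstar a = a" "cstar b = b" "a * b = b * (a :: 'a::cstar_algebra)"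
  shows "cstar (a + imag * b) * (a + imag * b) = a * a + b * b"
proof -
  have "cstar (a + imag * b) * (a + imag * b) = (a - imag * b) * (a + imag * b)"
    using assms by (simp add: imag_central)
  also have "\<dots> = a * a + b * b"
    using assms(3) by (simp add: algebra_simps imag_left_commute[of a] imag_left_commute[of b])
  finally show ?thesis .
qed

text \<open>By the C*-identity a + ib vanishes, hence so does its adjoint a - ib, and a is half
  their sum.\<close>

lemma commuting_squares_sum_eq_0:
  assumes "cstar a = a" "cstar b = b" "a * b = b * (a :: 'a::cstar_algebra)" "a * a + b * b = 0"
  shows "a = 0"
proof -
  have z: "a + imag * b = 0"
    using cstar_mult_real_imag[OF assms(1-3)] assms(4) by - (rule cstar_mult_self_eq_0, simp)
  then have "cstar (a + imag * b) = 0" by simp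
  then have z': "a - imag * b = 0" using assms by (simp add: imag_central)
  have "2 *\<^sub>R a = (a + imag * b) + (a - imag * b)" by (simp add: scaleR_2)
  also have "\<dots> = 0" unfolding z z' by simp
  finally have "2 *\<^sub>R a = 0" .
  then show ?thesis by simp
qed

section \<open>Square roots inside the algebra\<close>

lemma contraction_mult:
  assumes "norm (x :: 'a::cstar_algebra) \<le> 1"
  shows "contraction ((*) x)" "contraction (\<lambda>y. y * x)"
proof -
  have "norm (x * y) \<le> norm y" "norm (y * x) \<le> norm y" for y
    using norm_mult_ineq[of x y] norm_mult_ineq[of y x] assms
      mult_right_mono[of "norm x" 1 "norm y"] by (auto simp: mult.commute)
  then show "contraction ((*) x)" "contraction (\<lambda>y. y * x)"
    by (auto simp: contraction_def bounded_linear_mult_right bounded_linear_mult_left)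
qed

text \<open>As for \<open>opsqrt\<close>, this is the square root of \<open>1 - x\<close>.\<close>

definition asqrt :: "'a::cstar_algebra \<Rightarrow> 'a" where
  "asqrt x = opsqrt ((*) x) 1"

context
  fixes x :: "'a::cstar_algebra"
  assumes x: "norm x \<le> 1"
begin

lemma opsqrt_mult: "opsqrt ((*) x) y = asqrt x * y"
  unfolding asqrt_def
  using opsqrt_intertwine[OF contraction_mult(1)[OF x] contraction_mult(1)[OF x], of "\<lambda>z. z * y" 1]
  by (simp add: bounded_linear_mult_left mult.assoc)

lemma asqrt_square: "asqrt x * asqrt x = 1 - x"
  using opsqrt_square[OF contraction_mult(1)[OF x], of 1]
  by (simp add: opsqrt_mult flip: asqrt_def)

text \<open>Multiplying by z from the left intertwines the left multiplications by y and by x, hence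
  their series. For x = y the root commutes with whatever commutes with x.\<close>

lemma asqrt_intertwine:
  assumes "norm y \<le> 1" "x * z = z * y"
  shows "asqrt x * z = z * asqrt y"
proof -
  have "z * opsqrt ((*) y) 1 = opsqrt ((*) x) (z * 1)"
    by (rule opsqrt_intertwine[OF contraction_mult(1)[OF assms(1)] contraction_mult(1)[OF x]])
      (simp_all add: bounded_linear_mult_right assms(2) flip: mult.assoc)
  then show ?thesis by (simp add: opsqrt_mult flip: asqrt_def)
qed

text \<open>\<open>cstar\<close> turns left multiplication by x into right multiplication by x;
  started at 1 both generate the powers of x, so the two series agree.\<close>

lemma cstar_asqrt:
  assumes "cstar x = x"
  shows "cstar (asqrt x) = asqrt x"
proof -
  have "cstar (opsqrt ((*) x) 1) = opsqrt (\<lambda>y. y * x) (cstar 1)"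
    by (rule opsqrt_intertwine[OF contraction_mult[OF x] bounded_linear_cstar]) (simp add: assms)
  moreover have "((*) x ^^ n) 1 = ((\<lambda>y. y * x) ^^ n) 1" for n
  proof -
    have "((*) x ^^ n) 1 = x ^ n" by (induction n) auto
    moreover have "((\<lambda>y. y * x) ^^ n) 1 = x ^ n" by (induction n) (auto simp: power_commutes)
    ultimately show ?thesis by simp
  qed
  ultimately show ?thesis by (simp add: asqrt_def opsqrt_def)
qed

lemma norm_1_diff_asqrt_le: "norm (1 - asqrt x) \<le> 1"
  unfolding asqrt_def using norm_diff_opsqrt_le[OF contraction_mult(1)[OF x], of 1] by simp

end

text \<open>Positivity of the spectrum, expressed through the norm: for self-adjoint \<open>a\<close> the spectrum lies
in \<open>[0, 2t]\<close> iff \<open>norm (t - a) \<le> t\<close>. In this form the sum of two positive elements is positive by the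
triangle inequality.\<close>

definition npos :: "'a::cstar_algebra \<Rightarrow> bool" where
  "npos a \<longleftrightarrow> cstar a = a \<and> (\<exists>t>0. norm (t *\<^sub>R 1 - a) \<le> t)"

lemma norm_scaleR_1_diff_mono:
  assumes "norm (t *\<^sub>R 1 - (a :: 'a::cstar_algebra)) \<le> t" "t \<le> t'"
  shows "norm (t' *\<^sub>R 1 - a) \<le> t'"
proof -
  have "norm (t' *\<^sub>R 1 - a) = norm ((t' - t) *\<^sub>R 1 + (t *\<^sub>R 1 - a))" by (simp add: algebra_simps)
  also have "\<dots> \<le> t'"
    using norm_triangle_ineq[of "(t' - t) *\<^sub>R (1::'a)" "t *\<^sub>R 1 - a"] assms by simp
  finally show ?thesis .
qed

lemma npos_scaleR:
  assumes "npos a" "0 < r"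
  shows "npos (r *\<^sub>R a)"
proof -
  obtain t where "t > 0" "norm (t *\<^sub>R 1 - a) \<le> t" using assms by (auto simp: npos_def)
  moreover have "(r * t) *\<^sub>R 1 - r *\<^sub>R a = r *\<^sub>R (t *\<^sub>R 1 - a)" by (simp add: algebra_simps)
  ultimately have "norm ((r * t) *\<^sub>R 1 - r *\<^sub>R a) \<le> r * t" "r * t > 0" using assms(2) by auto
  then show ?thesis using assms(1) unfolding npos_def by auto
qed

lemma npos_add:
  assumes "npos a" "npos b"
  shows "npos (a + b)"
proof -
  obtain s t where st: "s > 0" "norm (s *\<^sub>R 1 - a) \<le> s" "t > 0" "norm (t *\<^sub>R 1 - b) \<le> t"
    using assms by (auto simp: npos_def)
  have "norm ((s + t) *\<^sub>R 1 - (a + b)) = norm ((s *\<^sub>R 1 - a) + (t *\<^sub>R 1 - b))"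
    by (simp add: algebra_simps)
  also have "\<dots> \<le> s + t"
    using norm_triangle_ineq[of "s *\<^sub>R 1 - a" "t *\<^sub>R 1 - b"] st by simp
  finally have "norm ((s + t) *\<^sub>R 1 - (a + b)) \<le> s + t" .
  with st assms show ?thesis unfolding npos_def by (auto intro!: exI[of _ "s + t"])
qed

lemma npos_scaleR_1_diff:
  assumes "cstar a = a" "norm a \<le> t"
  shows "npos (t *\<^sub>R 1 - a)"
proof -
  \<comment> \<open>The radius in \<open>npos\<close> must be positive while t may be 0, hence t +
    1.\<close>
  have "norm ((t + 1) *\<^sub>R 1 - (t *\<^sub>R 1 - a)) \<le> t + 1"
    using assms norm_triangle_ineq[of 1 a] by (simp add: algebra_simps)
  moreover have "t + 1 > 0" using assms(2) norm_ge_zero[of a] by linarith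
  ultimately show ?thesis using assms(1) unfolding npos_def by auto
qed

text \<open>The square root of \<open>a\<close> for any \<open>t > 0\<close> with \<open>norm (t - a) \<le> t\<close>. Keeping \<open>t\<close> explicit
allows two square roots to be expanded with the same \<open>t\<close>, so that they intertwine.\<close>

definition nsqrt :: "real \<Rightarrow> 'a::cstar_algebra \<Rightarrow> 'a" where
  "nsqrt t a = sqrt t *\<^sub>R asqrt (1 - inverse t *\<^sub>R a)"

lemma norm_1_diff_scaled:
  assumes "t > 0" "norm (t *\<^sub>R 1 - (a :: 'a::cstar_algebra)) \<le> t"
  shows "norm (1 - inverse t *\<^sub>R a) \<le> 1"
proof -
  have "1 - inverse t *\<^sub>R a = inverse t *\<^sub>R (t *\<^sub>R 1 - a)" using assms by (simp add: algebra_simps)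
  then have "norm (1 - inverse t *\<^sub>R a) = norm (t *\<^sub>R 1 - a) / t" using assms by (simp add: divide_inverse)
  then show ?thesis using assms by simp
qed

lemma nsqrt_square:
  assumes "t > 0" "norm (t *\<^sub>R 1 - (a :: 'a::cstar_algebra)) \<le> t"
  shows "nsqrt t a * nsqrt t a = a"
proof -
  have "nsqrt t a * nsqrt t a = (sqrt t * sqrt t) *\<^sub>R (asqrt (1 - a /\<^sub>R t) * asqrt (1 - a /\<^sub>R t))"
    by (simp add: nsqrt_def)
  then show ?thesis
    using assms(1) asqrt_square[OF norm_1_diff_scaled[OF assms]] by simp
qed

lemma nsqrt_intertwine:
  assumes "t > 0" "norm (t *\<^sub>R 1 - (a :: 'a::cstar_algebra)) \<le> t" "norm (t *\<^sub>R 1 - b) \<le> t"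
    "a * z = z * b"
  shows "nsqrt t a * z = z * nsqrt t b"
  using assms asqrt_intertwine[OF norm_1_diff_scaled[OF assms(1,2)] norm_1_diff_scaled[OF assms(1,3)], of z]
  by (simp add: nsqrt_def algebra_simps)

lemma npos_nsqrt:
  assumes "t > 0" "norm (t *\<^sub>R 1 - (a :: 'a::cstar_algebra)) \<le> t" "cstar a = a"
  shows "npos (nsqrt t a)"
  unfolding nsqrt_def
proof (rule npos_scaleR)
  show "npos (asqrt (1 - inverse t *\<^sub>R a))"
    unfolding npos_def
    using norm_1_diff_asqrt_le[OF norm_1_diff_scaled[OF assms(1,2)]]
      cstar_asqrt[OF norm_1_diff_scaled[OF assms(1,2)]] assms(3)
    by (auto intro!: exI[of _ 1])
qed (use assms in simp)

lemma npos_sqrt_exists: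
  assumes "npos a"
  obtains s where "npos s" "s * s = a" "\<And>z. a * z = z * a \<Longrightarrow> s * z = z * s"
proof -
  obtain t where "cstar a = a" "t > 0" "norm (t *\<^sub>R 1 - a) \<le> t" using assms by (auto simp: npos_def)
  with that[of "nsqrt t a"] show ?thesis
    using npos_nsqrt nsqrt_square nsqrt_intertwine by metis
qed

text \<open>After rescaling h to norm at most 1, the radius 1 works: 1 - h^2 is the square of a
  self-adjoint s, so a bound on the norm of s suffices.\<close>

lemma npos_square:
  assumes h: "cstar h = (h :: 'a::cstar_algebra)"
  shows "npos (h * h)"
proof -
  have one: "npos (h * h)" if h: "cstar h = h" "norm h \<le> 1" for h :: 'a
  proof -
    have n: "norm (h * h) \<le> 1" using h by (simp add: selfadjoint_square_norm power_le_one)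
    define s where "s = asqrt (h * h)"
    have s: "s * s = 1 - h * h" "cstar s = s" "s * h = h * s"
      using asqrt_square[OF n] cstar_asqrt[OF n] asqrt_intertwine[OF n n, of h] h
      by (simp_all add: s_def mult.assoc)
    define u where "u = h + imag * s"
    \<comment> \<open>\<open>u\<close> is unitary with imaginary part \<open>s\<close>, so \<open>norm s \<le> 1\<close>.\<close>
    have "cstar u * u = 1"
      unfolding u_def using cstar_mult_real_imag[of h s] h s by simp
    then have nu: "norm u = 1" using cstar_identity[of u] power2_eq_1_iff[of "norm u"] norm_ge_zero[of u] by auto
    have "imag * (cstar u - u) = 2 *\<^sub>R s"
      using h s(2) by (simp add: u_def scaleR_2 right_diff_distrib distrib_left flip: imag_central)
    moreover have "norm (imag * (cstar u - u)) \<le> 2"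
      using norm_cscale[of 0 "cstar u - u" 1] norm_triangle_ineq4[of "cstar u" u] nu
      by (simp add: cmod_def)
    ultimately have "norm (2 *\<^sub>R s) \<le> 2" by simp
    then have "norm s \<le> 1" by simp
    then have "norm (s * s) \<le> 1" using s(2) by (simp add: selfadjoint_square_norm power_le_one)
    then show ?thesis unfolding npos_def using h s(1) by (auto intro!: exI[of _ 1])
  qed
  define r where "r = norm h + 1"
  have r: "r > 0" "norm h \<le> r" by (auto simp: r_def add_nonneg_pos)
  have "npos ((inverse r *\<^sub>R h) * (inverse r *\<^sub>R h))"
    by (rule one) (use r h in \<open>auto simp: field_simps\<close>)
  from npos_scaleR[OF this, of "r * r"] have "npos ((r * r * (inverse r * inverse r)) *\<^sub>R (h * h))"
    using r by simp
  then show ?thesis using r by (simp add: field_simps)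
qed

lemma mult_swap_middle:
  fixes a :: "'a::semigroup_mult"
  assumes "b * d = d * b"
  shows "(a * d) * (b * d) = (a * b) * (d * d)"
  by (metis assms mult.assoc)

text \<open>With d = s - p one has d (s + p) = 0. Writing s = a^2 and p = b^2, with a and b
  commuting with each other and with d, gives (ad)^2 + (bd)^2 = d (s + p) d = 0. Hence ad = bd = 0,
  so sd = pd = 0 and d^2 = 0.\<close>

lemma npos_sqrt_unique:
  assumes "npos s" "npos p" "s * p = p * s" "s * s = p * (p :: 'a::cstar_algebra)"
  shows "s = p"
proof -
  define d where "d = s - p"
  have sa: "cstar s = s" "cstar p = p" "cstar d = d" using assms by (auto simp: npos_def d_def)
  have comm: "s * d = d * s" "p * d = d * p" using assms(3) by (auto simp: d_def algebra_simps)
  have d0: "d * (s + p) = 0" using assms(3,4) by (simp add: d_def algebra_simps)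
  obtain a where a: "npos a" "a * a = s" "\<And>z. s * z = z * s \<Longrightarrow> a * z = z * a"
    using npos_sqrt_exists[OF assms(1)] by blast
  obtain b where b: "npos b" "b * b = p" "\<And>z. p * z = z * p \<Longrightarrow> b * z = z * b"
    using npos_sqrt_exists[OF assms(2)] by blast
  have ad: "a * d = d * a" "b * d = d * b" using a(3) b(3) comm by auto
  have "p * a = a * p" using a(3)[of p] assms(3) by simp
  then have ab: "a * b = b * a" using b(3)[of a] by simp
  have ca: "cstar a = a" "cstar b = b" using a(1) b(1) by (auto simp: npos_def)
  have aa: "(a * d) * (a * d) = s * (d * d)" "(b * d) * (b * d) = p * (d * d)"
    using mult_swap_middle[OF ad(1), of a] mult_swap_middle[OF ad(2), of b] a(2) b(2) by simp_all
  have "d * (s + p) = s * d + p * d" by (simp add: distrib_left comm)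
  then have "s * (d * d) + p * (d * d) = d * (s + p) * d" by (simp add: distrib_right mult.assoc)
  then have sum0: "(a * d) * (a * d) + (b * d) * (b * d) = 0" using d0 aa by simp
  have cc: "(a * d) * (b * d) = (b * d) * (a * d)"
    using mult_swap_middle[OF ad(2), of a] mult_swap_middle[OF ad(1), of b] ab by simp
  have "a * d = 0"
    by (rule commuting_squares_sum_eq_0[OF _ _ cc sum0]) (use ca sa ad in auto)
  moreover have "b * d = 0"
    by (rule commuting_squares_sum_eq_0[OF _ _ cc[symmetric]]) (use ca sa ad sum0 in \<open>auto simp: add.commute\<close>)
  ultimately have "s * d = 0" "p * d = 0" by (simp_all add: mult.assoc flip: a(2) b(2))
  then have "d * d = 0" by (simp add: d_def left_diff_distrib)
  then have "d = 0" using cstar_mult_self_eq_0[of d] sa by simp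
  then show ?thesis by (simp add: d_def)
qed

text \<open>Uniqueness identifies p with the series root of its square, so intertwining relations
  between squares descend to the positive elements themselves.\<close>

lemma nsqrt_of_square:
  assumes "npos p" "m > 0" "norm (m *\<^sub>R 1 - p * (p :: 'a::cstar_algebra)) \<le> m"
  shows "nsqrt m (p * p) = p"
proof (rule npos_sqrt_unique)
  show "npos (nsqrt m (p * p))" using assms by (intro npos_nsqrt) (auto simp: npos_def)
  show "nsqrt m (p * p) * p = p * nsqrt m (p * p)"
    by (rule nsqrt_intertwine[OF assms(2,3,3)]) (simp add: mult.assoc)
  show "nsqrt m (p * p) * nsqrt m (p * p) = p * p" by (rule nsqrt_square[OF assms(2,3)])
qed (rule assms(1))

text \<open>A substitute for comparing the spectra of \<open>y * cstar y\<close> and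
  \<open>cstar y * y\<close>. Associativity gives q z = - z p for z = \<open>cstar y\<close>. Hence
  z intertwines the squares of p and q, so also their positive roots: q z = z p. Together q z = 0,
  whence q^2 = 0.\<close>

lemma npos_mult_cstar_of_neg:
  assumes "y * cstar y = (p :: 'a::cstar_algebra)" "npos p" "cstar y * y = - q" "npos q"
  shows "y = 0"
proof -
  have sa: "cstar p = p" "cstar q = q" using assms by (auto simp: npos_def)
  let ?z = "cstar y"
  have qz: "q * ?z = - (?z * p)"
  proof -
    have "q = - (?z * y)" using assms(3) by simp
    then show ?thesis by (simp add: mult.assoc flip: assms(1))
  qed
  have "(q * q) * ?z = ?z * (p * p)"
  proof -
    have "(q * q) * ?z = q * (q * ?z)" by (simp add: mult.assoc)
    also have "\<dots> = - (q * ?z * p)" by (subst qz) (simp add: mult.assoc)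
    also have "\<dots> = ?z * (p * p)" unfolding qz by (simp add: mult.assoc)
    finally show ?thesis .
  qed
  obtain s t where "s > 0" "norm (s *\<^sub>R 1 - p * p) \<le> s" "t > 0" "norm (t *\<^sub>R 1 - q * q) \<le> t"
    using npos_square[OF sa(1)] npos_square[OF sa(2)] unfolding npos_def by auto
  \<comment> \<open>\<open>nsqrt_intertwine\<close> needs a common radius for both squares.\<close>
  then obtain m where m: "m > 0" "norm (m *\<^sub>R 1 - p * p) \<le> m" "norm (m *\<^sub>R 1 - q * q) \<le> m"
    using norm_scaleR_1_diff_mono[of s "p * p" "max s t"] norm_scaleR_1_diff_mono[of t "q * q" "max s t"]
    by (intro that[of "max s t"]) auto
  have "nsqrt m (p * p) = p" "nsqrt m (q * q) = q"
    using nsqrt_of_square m assms(2,4) by blast+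
  then have "q * ?z = ?z * p"
    using nsqrt_intertwine[OF m(1,3,2) \<open>(q * q) * ?z = ?z * (p * p)\<close>] by simp
  with qz have "q * ?z = - (q * ?z)" by simp
  then have "2 *\<^sub>R (q * ?z) = 0" unfolding scaleR_2 by (simp only: eq_neg_iff_add_eq_0)
  then have "q * ?z * y = 0" by simp
  then have "q * q = 0" using assms(3) by (simp add: mult.assoc)
  then have "q = 0" using cstar_mult_self_eq_0[of q] sa by simp
  then show ?thesis using cstar_mult_self_eq_0[of y] assms(3) by simp
qed

text \<open>Kaplansky's argument: with \<open>h = x\<^sup>*x\<close>, \<open>m = |h|\<close> and \<open>y = x(m - h)\<close>, both \<open>- y\<^sup>*y\<close> and \<open>yy\<^sup>*\<close>
are positive, which forces \<open>y = 0\<close> and then \<open>m = h\<close>.\<close>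

lemma npos_cstar_mult_self: "npos (cstar x * (x :: 'a::cstar_algebra))"
proof -
  define h where "h = cstar x * x"
  have h: "cstar h = h" by (simp add: h_def)
  obtain m where m: "npos m" "m * m = h * h" "\<And>z. h * h * z = z * (h * h) \<Longrightarrow> m * z = z * m"
    using npos_sqrt_exists[OF npos_square[OF h]] by blast
  have mh: "m * h = h * m" using m(3)[of h] by (simp add: mult.assoc)
  obtain r where r: "npos r" "r * r = m" "\<And>z. m * z = z * m \<Longrightarrow> r * z = z * r"
    using npos_sqrt_exists[OF m(1)] by blast
  define g where "g = m - h"
  have sa: "cstar m = m" "cstar r = r" "cstar g = g"
    using m(1) r(1) h by (auto simp: npos_def g_def)
  have gm: "m * g = g * m" "h * g = g * h" using mh by (auto simp: g_def algebra_simps)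
  have rg: "r * g = g * r" using r(3) gm by simp
  have gh0: "(m + h) * g = 0" using m(2) mh by (simp add: g_def algebra_simps)
  define y where "y = x * g"
  \<comment> \<open>By \<open>gh0\<close> hg = -mg, which turns this product into - (rg)^2.\<close>
  have "cstar y * y = g * h * g" using sa by (simp add: y_def h_def mult.assoc)
  also have "\<dots> = h * g * g" using gm by simp
  also have "h * g = - (m * g)" using gh0 by (simp add: distrib_right eq_neg_iff_add_eq_0 add.commute)
  also have "- (m * g) * g = - ((r * g) * (r * g))"
    using mult_swap_middle[OF rg, of r] r(2) by (simp add: mult.assoc)
  finally have 1: "cstar y * y = - ((r * g) * (r * g))" .
  have 2: "npos ((r * g) * (r * g))" by (rule npos_square) (use sa rg in simp)
  \<comment> \<open>a and b are the real and imaginary parts of y; a^2 + b^2 is half of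
    \<open>y * cstar y + cstar y * y\<close>, so \<open>y * cstar y\<close> becomes a sum of
    squares.\<close>
  define a where "a = (1/2) *\<^sub>R (y + cstar y)"
  define b where "b = (1/2) *\<^sub>R (imag * (cstar y - y))"
  have ab: "cstar a = a" "cstar b = b"
    by (auto simp: a_def b_def add.commute left_diff_distrib right_diff_distrib imag_central)
  have "a * a = (1/4) *\<^sub>R (y * y + y * cstar y + cstar y * y + cstar y * cstar y)"
    by (simp add: a_def algebra_simps)
  moreover have "b * b = (1/4) *\<^sub>R (- (y * y) + y * cstar y + cstar y * y - cstar y * cstar y)"
    by (simp add: b_def algebra_simps imag_left_commute[of y] imag_left_commute[of "cstar y"])
  ultimately have "a * a + b * b = (1/4) *\<^sub>R (2 *\<^sub>R (y * cstar y + cstar y * y))"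
    by (simp add: algebra_simps scaleR_2)
  then have "y * cstar y = 2 *\<^sub>R (a * a + b * b) + (r * g) * (r * g)"
    using 1 by simp
  then have "npos (y * cstar y)"
    using npos_square[OF ab(1)] npos_square[OF ab(2)] 2 by (simp add: npos_add npos_scaleR)
  then have "y = 0" using npos_mult_cstar_of_neg[OF refl _ 1 2] by simp
  then have "h * g = 0" by (simp add: h_def y_def mult.assoc)
  then have "m * g = 0" using gh0 by (simp add: distrib_right)
  with \<open>h * g = 0\<close> have "g * g = 0" by (simp add: g_def left_diff_distrib)
  then have "g = 0" using cstar_mult_self_eq_0[of g] sa by simp
  then show ?thesis using m(1) by (simp add: g_def h_def)
qed

text \<open>Kaplansky's argument gives one direction, a self-adjoint root the other. Closure of
  \<open>ca_pos\<close> under addition is then inherited from \<open>npos\<close>.\<close>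

lemma ca_pos_iff_npos: "ca_pos a \<longleftrightarrow> npos a"
proof
  assume "npos a"
  then obtain s where "npos s" "s * s = a" using npos_sqrt_exists by blast
  then have "a = cstar s * s" by (simp add: npos_def)
  then show "ca_pos a" unfolding ca_pos_def by blast
qed (auto simp: ca_pos_def npos_cstar_mult_self)

section \<open>The order on the algebra\<close>

lemma ca_pos_selfadjoint: "ca_pos a \<Longrightarrow> cstar a = a"
  by (auto simp: ca_pos_def)

lemma ca_pos_0 [simp]: "ca_pos 0"
  by (auto simp: ca_pos_def intro!: exI[of _ 0])

lemma ca_pos_add: "ca_pos a \<Longrightarrow> ca_pos b \<Longrightarrow> ca_pos (a + b)"
  by (simp add: ca_pos_iff_npos npos_add)

lemma ca_pos_scaleR: "ca_pos a \<Longrightarrow> 0 \<le> r \<Longrightarrow> ca_pos (r *\<^sub>R a)"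
  by (cases "r = 0") (simp_all add: ca_pos_iff_npos[of a] ca_pos_iff_npos[of "r *\<^sub>R a"] npos_scaleR)

lemma ca_pos_conjugate: "ca_pos a \<Longrightarrow> ca_pos (x * a * cstar x)"
proof -
  assume "ca_pos a"
  then obtain b where "a = cstar b * b" by (auto simp: ca_pos_def)
  then have "x * a * cstar x = cstar (b * cstar x) * (b * cstar x)" by (simp add: mult.assoc)
  then show ?thesis unfolding ca_pos_def by blast
qed

lemma ca_le_trans: "ca_le a b \<Longrightarrow> ca_le b c \<Longrightarrow> ca_le a c"
  using ca_pos_add[of "b - a" "c - b"] by (simp add: ca_le_def)

lemma ca_le_conjugate: "ca_le a b \<Longrightarrow> ca_le (x * a * cstar x) (x * b * cstar x)"
  using ca_pos_conjugate[of "b - a" x] by (simp add: ca_le_def algebra_simps)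

lemma ca_le_scaleR: "ca_le a b \<Longrightarrow> 0 \<le> r \<Longrightarrow> ca_le (r *\<^sub>R a) (r *\<^sub>R b)"
  using ca_pos_scaleR[of "b - a" r] by (simp add: ca_le_def algebra_simps)

lemma ca_le_norm: "cstar a = a \<Longrightarrow> ca_le a (norm a *\<^sub>R 1)"
  by (simp add: ca_le_def ca_pos_iff_npos npos_scaleR_1_diff)

text \<open>With r = norm b, both a and r - a are positive. Their roots s and d commute and u = s +
  id satisfies \<open>cstar u * u = r\<close>. So s, the real part of u, has norm at most sqrt r,
  and a = s^2.\<close>

lemma norm_mono_ca_le:
  assumes "ca_pos a" "ca_le a b"
  shows "norm a \<le> norm b"
proof -
  define r where "r = norm b"
  have "cstar (b - a) = b - a" "cstar a = a" using assms ca_pos_selfadjoint[of a] ca_pos_selfadjoint[of "b - a"] by (simp_all only: ca_le_def)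
  then have "ca_le b (r *\<^sub>R 1)" unfolding r_def by (intro ca_le_norm) simp
  then have "npos (r *\<^sub>R 1 - a)" "npos a"
    using ca_le_trans[OF assms(2)] assms(1) by (auto simp: ca_le_def ca_pos_iff_npos)
  obtain s where s: "npos s" "s * s = a" "\<And>z. a * z = z * a \<Longrightarrow> s * z = z * s"
    using npos_sqrt_exists[OF \<open>npos a\<close>] by blast
  obtain d where d: "npos d" "d * d = r *\<^sub>R 1 - a" "\<And>z. (r *\<^sub>R 1 - a) * z = z * (r *\<^sub>R 1 - a) \<Longrightarrow> d * z = z * d"
    using npos_sqrt_exists[OF \<open>npos (r *\<^sub>R 1 - a)\<close>] by blast
  have sa: "cstar s = s" "cstar d = d" using s(1) d(1) by (auto simp: npos_def)
  have "a * s = s * a" using s(2) by (auto simp: mult.assoc)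
  then have "s * d = d * s" using d(3)[of s] by (simp add: algebra_simps)
  define u where "u = s + imag * d"
  have "cstar u * u = r *\<^sub>R 1"
    unfolding u_def using cstar_mult_real_imag[OF sa \<open>s * d = d * s\<close>] s(2) d(2) by simp
  then have nu: "norm u ^ 2 = r" using cstar_identity[of u] by (simp add: r_def)
  have "2 *\<^sub>R s = u + cstar u"
    using sa by (simp add: u_def scaleR_2 imag_central)
  then have "2 * norm s \<le> 2 * norm u"
    using norm_triangle_ineq[of u "cstar u"] by (metis norm_cstar mult_2 norm_scaleR abs_numeral)
  then have "norm s ^ 2 \<le> r" using nu power_mono[of "norm s" "norm u" 2] by simp
  then show ?thesis using s(2) sa by (simp add: r_def flip: selfadjoint_square_norm)
qed

section \<open>Operators on Hilbert modules\<close>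

locale hilbert_mod =
  fixes act :: "'a::cstar_algebra \<Rightarrow> 'h::banach \<Rightarrow> 'h"
    and ip :: "'h \<Rightarrow> 'h \<Rightarrow> 'a"
  assumes hilbert_module: "hilbert_module act ip"
begin

section \<open>Inner product calculus and Cauchy-Schwarz\<close>

lemma act_of_real: "act (of_real r) f = r *\<^sub>R f"
  and ip_add_left: "ip (f + g) h = ip f h + ip g h"
  and ip_act_left: "ip (act a f) g = a * ip f g"
  and ip_commute: "ip g f = cstar (ip f g)"
  and ip_pos: "ca_pos (ip f f)"
  and ip_self_eq_0: "ip f f = 0 \<Longrightarrow> f = 0"
  and norm_eq_ip: "norm f = sqrt (norm (ip f f))"
  using hilbert_module unfolding hilbert_module_def by meson+

lemma ip_scaleR_left: "ip (r *\<^sub>R f) g = r *\<^sub>R ip f g"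
  using ip_act_left[of "of_real r" f g] unfolding act_of_real by (simp add: of_real_def)

lemma ip_minus_left: "ip (- f) g = - ip f g"
  using ip_scaleR_left[of "-1" f g] by simp

lemma ip_diff_left: "ip (f - g) h = ip f h - ip g h"
  using ip_add_left[of f "- g" h] by (simp add: ip_minus_left)

lemma ip_add_right: "ip f (g + h) = ip f g + ip f h"
  by (subst (1 2 3) ip_commute) (simp add: ip_add_left)

lemma ip_act_right: "ip f (act a g) = ip f g * cstar a"
  by (subst (1 2) ip_commute) (simp add: ip_act_left)

lemma ip_scaleR_right: "ip f (r *\<^sub>R g) = r *\<^sub>R ip f g"
  by (subst (1 2) ip_commute) (simp add: ip_scaleR_left)

lemma ip_diff_right: "ip f (g - h) = ip f g - ip f h"
  by (subst (1 2 3) ip_commute) (simp add: ip_diff_left)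

lemma ip_zero_right: "ip f 0 = 0"
  using ip_scaleR_right[of f 0 0] by simp

lemmas ip_simps = ip_add_left ip_add_right ip_diff_left ip_diff_right ip_scaleR_left ip_scaleR_right
  ip_act_left ip_act_right

lemma norm_ip_self: "norm (ip f f) = norm f ^ 2"
  by (simp add: norm_eq_ip)

lemma ip_left_cong: "f = f'" if "\<And>g. ip f g = ip f' g"
  using that ip_self_eq_0[of "f - f'"] by (simp add: ip_diff_left)

lemma ip_right_cong: "g = g'" if "\<And>f. ip f g = ip f g'"
  using that ip_self_eq_0[of "g - g'"] by (simp add: ip_diff_right)

text \<open>Expand the positive element \<open>ip h h\<close> for h = t f - a g, with a =
  \<open>ip f g\<close> and t = norm g ^ 2. Bounding \<open>ip g g\<close> by t leaves t a a^* below
  t^2 \<open>ip f f\<close>, and norms are monotone on the cone.\<close>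

lemma norm_ip_le: "norm (ip f g) \<le> norm f * norm g"
proof (cases "g = 0")
  case True
  then show ?thesis by (simp add: ip_zero_right)
next
  case False
  define a where "a = ip f g"
  define t where "t = norm g ^ 2"
  have t: "t > 0" using False by (simp add: t_def)
  define h where "h = t *\<^sub>R f - act a g"
  have gf: "ip g f = cstar a" by (simp add: a_def ip_commute[of g f])
  have hh: "ip h h = (t * t) *\<^sub>R ip f f - t *\<^sub>R (a * cstar a) - t *\<^sub>R (a * cstar a) + a * ip g g * cstar a"
    by (simp add: h_def ip_simps gf flip: a_def) (simp add: algebra_simps)
  have "ca_le (a * ip g g * cstar a) (a * (t *\<^sub>R 1) * cstar a)"
    using ca_le_norm[of "ip g g"] ca_pos_selfadjoint[OF ip_pos]
    by (intro ca_le_conjugate) (simp add: norm_ip_self t_def)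
  then have "ca_pos (t *\<^sub>R (a * cstar a) - a * ip g g * cstar a)"
    by (simp add: ca_le_def)
  from ca_pos_add[OF ip_pos[of h] this]
  have "ca_le (t *\<^sub>R (a * cstar a)) ((t * t) *\<^sub>R ip f f)"
    unfolding hh ca_le_def by (simp add: algebra_simps)
  moreover have "ca_pos (t *\<^sub>R (a * cstar a))"
    using t by (intro ca_pos_scaleR) (auto simp: ca_pos_def intro!: exI[of _ "cstar a"])
  ultimately have "norm (t *\<^sub>R (a * cstar a)) \<le> norm ((t * t) *\<^sub>R ip f f)"
    by (rule norm_mono_ca_le[rotated])
  then have "t * norm a ^ 2 \<le> t * (t * norm f ^ 2)"
    using t cstar_identity[of "cstar a"] by (simp add: norm_ip_self mult.assoc)
  then have "norm a ^ 2 \<le> (norm f * norm g) ^ 2"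
    using t by (simp add: t_def power_mult_distrib mult.commute)
  then show ?thesis unfolding a_def by (rule power2_le_imp_le) simp
qed

lemma bounded_linear_ip_left: "bounded_linear (\<lambda>f. ip f g)"
  by (rule bounded_linear_intro[where K = "norm g"]) (auto simp: ip_simps norm_ip_le)

lemma bounded_linear_ip_right: "bounded_linear (ip f)"
  by (rule bounded_linear_intro[where K = "norm f"])
    (use norm_ip_le[of f] in \<open>simp_all add: ip_simps mult.commute[of "norm f"]\<close>)

section \<open>Adjoint pairs and their automatic boundedness\<close>

definition adj_pair :: "('h \<Rightarrow> 'h) \<Rightarrow> ('h \<Rightarrow> 'h) \<Rightarrow> bool" where
  "adj_pair T T' \<longleftrightarrow> (\<forall>f g. ip (T f) g = ip f (T' g))"

lemma adj_pairD: "adj_pair T T' \<Longrightarrow> ip (T f) g = ip f (T' g)"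
  by (simp add: adj_pair_def)

lemma adj_pair_sym: "adj_pair T T' \<Longrightarrow> adj_pair T' T"
  unfolding adj_pair_def by (metis ip_commute)

lemma adj_pair_comp: "adj_pair S S' \<Longrightarrow> adj_pair T T' \<Longrightarrow> adj_pair (\<lambda>f. S (T f)) (\<lambda>f. T' (S' f))"
  by (simp add: adj_pair_def)

lemma adjointable_iff_adj_pair: "adjointable ip T \<longleftrightarrow> (\<exists>T'. adj_pair T T')"
  by (simp add: adjointable_def adj_pair_def)

lemma adj_pair_adjoint: "adjointable ip T \<Longrightarrow> adj_pair T (adjoint ip T)"
  using someI_ex[of "\<lambda>T'. \<forall>f g. ip (T f) g = ip f (T' g)"]
  unfolding adjointable_def adj_pair_def adjoint_def by blast

text \<open>The sets \<open>E n = {f. norm (T f) \<le> n}\<close> are closed because the adjoint turns them into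
intersections of closed sets; Baire's theorem then bounds \<open>T\<close> on a ball.\<close>

lemma adj_pair_bounded_linear:
  assumes T: "adj_pair T T'"
  shows "bounded_linear T"
proof -
  \<comment> \<open>Linearity follows from the adjoint identity and nondegeneracy of
    \<open>ip\<close>.\<close>
  have lin: "linear T"
    by (rule linearI) (auto intro!: ip_left_cong simp: ip_simps adj_pairD[OF T])
  define E where "E n = {f. norm (T f) \<le> real n}" for n
  have E_eq: "E n = (\<Inter>g. {f. norm (ip f (T' g)) \<le> real n * norm g})" for n
  proof safe
    fix f g assume "f \<in> E n"
    then show "norm (ip f (T' g)) \<le> real n * norm g"
      using norm_ip_le[of "T f" g] mult_right_mono[of "norm (T f)" "real n" "norm g"]
      by (simp add: E_def adj_pairD[OF T])
  next
    fix f assume "f \<in> (\<Inter>g. {f. norm (ip f (T' g)) \<le> real n * norm g})"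
    then have "norm (ip f (T' (T f))) \<le> real n * norm (T f)" by blast
    then have "norm (T f) * norm (T f) \<le> real n * norm (T f)"
      by (simp add: norm_ip_self power2_eq_square flip: adj_pairD[OF T])
    then show "f \<in> E n" by (cases "T f = 0") (auto simp: E_def)
  qed
  have closed: "closed (E n)" for n
    unfolding E_eq
    by (intro closed_INT ballI closed_Collect_le continuous_intros
        linear_continuous_on[OF bounded_linear_ip_left])
  obtain n where n: "interior (E n) \<noteq> {}"
  proof (rule ccontr)
    assume "\<not> thesis"
    then have "interior (E n) = {}" for n using that by blast
    moreover have "Met_TC.mcomplete TYPE('h)" by (simp add: complete_UNIV)
    ultimately have "euclidean interior_of \<Union>(range E) = {}"
      using Met_TC.metric_Baire_category_alt[of "range E"] closed by auto
    moreover have "\<Union>(range E) = UNIV"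
      using real_arch_simple by (auto simp: E_def)
    ultimately show False by simp
  qed
  then obtain x e where e: "e > 0" "ball x e \<subseteq> E n"
    by (metis all_not_in_conv mem_interior)
  have "norm (T f) \<le> norm f * (4 * real n / e)" for f
  proof (cases "f = 0")
    case True
    then show ?thesis using linear_0[OF lin] by simp
  next
    case False
    \<comment> \<open>This keeps x + r f within distance e/2 of x, so T is bounded at both x and x +
      r f.\<close>
    define r where "r = e / (2 * norm f)"
    have r: "r > 0" using e False by (simp add: r_def)
    have "x + r *\<^sub>R f \<in> E n" "x \<in> E n"
      using e False by (auto intro!: subsetD[OF e(2)] simp: dist_norm r_def)
    then have "norm (T (x + r *\<^sub>R f) - T x) \<le> 2 * real n"
      using norm_triangle_ineq4[of "T (x + r *\<^sub>R f)" "T x"] by (simp add: E_def)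
    then have "r * norm (T f) \<le> 2 * real n"
      using r by (simp add: linear_add[OF lin] linear_scale[OF lin])
    then show ?thesis using e False by (simp add: r_def field_simps)
  qed
  then show ?thesis using lin by (intro bounded_linear_intro[of T "4 * real n / e"]) (auto simp: linear_add linear_scale)
qed

section \<open>Square roots of positive operators\<close>

lemma adj_pair_opsqrt:
  assumes X: "contraction X" "adj_pair X X"
  shows "adj_pair (opsqrt X) (opsqrt X)"
  unfolding adj_pair_def
proof safe
  fix f g
  have "ip ((X ^^ n) f) g = ip f ((X ^^ n) g)" for n
    by (induction n arbitrary: f g) (auto simp: adj_pairD[OF X(2)] funpow_swap1)
  then have "((\<lambda>n. ip (sqc n *\<^sub>R (X ^^ n) f) g) has_sum ip f (opsqrt X g)) UNIV"
    using has_sum_bounded_linear[OF bounded_linear_ip_right opsqrt_has_sum[OF X(1)], of f g]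
    by (simp add: ip_simps)
  then show "ip (opsqrt X f) g = ip f (opsqrt X g)"
    using has_sum_bounded_linear[OF bounded_linear_ip_left opsqrt_has_sum[OF X(1)], of f g]
      has_sum_unique by blast
qed

lemma scaled_contraction:
  assumes "bounded_linear (T :: 'h \<Rightarrow> 'h)"
  obtains t where "t > 0" "contraction (\<lambda>f. inverse t *\<^sub>R T f)"
proof -
  obtain t where t: "t > 0" "\<And>f. norm (T f) \<le> norm f * t"
    using bounded_linear.pos_bounded[OF assms] by blast
  then have "norm (inverse t *\<^sub>R T f) \<le> norm f" for f
    by (simp add: field_simps)
  then show ?thesis
    using t assms by (intro that[of t]) (auto simp: contraction_def intro: bounded_linear_const_scaleR)
qed

lemma adj_pair_scaleR: "adj_pair T T' \<Longrightarrow> adj_pair (\<lambda>f. r *\<^sub>R T f) (\<lambda>f. r *\<^sub>R T' f)"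
  by (simp add: adj_pair_def ip_simps)

text \<open>For M large, D = sqrt (1 - T'T/M) exists and is self-adjoint, and the difference of
  \<open>ip f f\<close> and \<open>ip (T f) (T f)\<close> divided by M is
  \<open>ip (D f) (D f)\<close>.\<close>

lemma adj_pair_ip_bound:
  assumes T: "adj_pair T T'"
  obtains M where "M > 0" "\<And>f. ca_le (ip (T f) (T f)) (M *\<^sub>R ip f f)"
proof -
  have TT: "adj_pair (\<lambda>f. T' (T f)) (\<lambda>f. T' (T f))"
    by (rule adj_pair_comp[OF adj_pair_sym[OF T] T])
  obtain M where M: "M > 0" "contraction (\<lambda>f. inverse M *\<^sub>R T' (T f))"
    using scaled_contraction[OF adj_pair_bounded_linear[OF TT]] by blast
  define D where "D = opsqrt (\<lambda>f. inverse M *\<^sub>R T' (T f))"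
  have D: "adj_pair D D" unfolding D_def by (rule adj_pair_opsqrt[OF M(2) adj_pair_scaleR[OF TT]])
  have "ca_le (ip (T f) (T f)) (M *\<^sub>R ip f f)" for f
  proof -
    have "ip (D f) (D f) = ip f (f - inverse M *\<^sub>R T' (T f))"
      unfolding adj_pairD[OF D] by (simp add: D_def opsqrt_square[OF M(2)])
    also have "\<dots> = ip f f - inverse M *\<^sub>R ip (T f) (T f)"
      by (simp add: ip_simps adj_pairD[OF T])
    finally have "ca_pos (M *\<^sub>R (ip f f - inverse M *\<^sub>R ip (T f) (T f)))"
      using ip_pos[of "D f"] M(1) by (intro ca_pos_scaleR) auto
    then show ?thesis using M(1) by (simp add: ca_le_def scaleR_diff_right)
  qed
  with M(1) show ?thesis by (rule that)
qed

text \<open>The series yields roots of 1 - X, so C/t is written as 1 - X. That X = 1 - C/t is a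
  contraction uses positivity: with D = sqrt (1 - C/t), so that D^2 = X, the element
  \<open>ip f f - ip (D f) (D f)\<close> equals \<open>ip (C f) f\<close> divided by t, so D does
  not increase norms.\<close>

lemma positive_operator_sqrt:
  assumes C: "adj_pair C C" and pos: "\<And>f. ca_pos (ip (C f) f)"
  obtains R where "adj_pair R R" "\<And>f. R (R f) = C f"
    "\<And>T f. bounded_linear T \<Longrightarrow> (\<And>f. T (C f) = C (T f)) \<Longrightarrow> T (R f) = R (T f)"
proof -
  note blC = adj_pair_bounded_linear[OF C]
  obtain t where t: "t > 0" "contraction (\<lambda>f. inverse t *\<^sub>R C f)"
    using scaled_contraction[OF blC] by blast
  define D where "D = opsqrt (\<lambda>f. inverse t *\<^sub>R C f)"
  define X where "X f = f - inverse t *\<^sub>R C f" for f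
  have D: "adj_pair D D" unfolding D_def by (rule adj_pair_opsqrt[OF t(2) adj_pair_scaleR[OF C]])
  have DD: "D (D f) = X f" for f unfolding D_def X_def by (rule opsqrt_square[OF t(2)])
  have X: "adj_pair X X" using adj_pair_scaleR[OF C] by (simp add: adj_pair_def X_def ip_diff_left ip_diff_right)
  have nD: "norm (D f) \<le> norm f" for f
  proof -
    have "ip f f - ip (D f) (D f) = inverse t *\<^sub>R ip (C f) f"
      unfolding adj_pairD[OF D] DD by (simp add: X_def ip_simps adj_pairD[OF C])
    then have "ca_le (ip (D f) (D f)) (ip f f)"
      using pos t by (simp add: ca_le_def ca_pos_scaleR)
    from norm_mono_ca_le[OF ip_pos this] have "norm (D f) ^ 2 \<le> norm f ^ 2" by (simp add: norm_ip_self)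
    then show ?thesis by (rule power2_le_imp_le) simp
  qed
  have cX: "contraction X"
    unfolding contraction_def using adj_pair_bounded_linear[OF X] order_trans[OF nD nD]
    by (simp flip: DD)
  define R where "R f = sqrt t *\<^sub>R opsqrt X f" for f
  note linE = bounded_linear.linear[OF bounded_linear_opsqrt[OF cX]]
  have "adj_pair R R" unfolding R_def by (intro adj_pair_scaleR adj_pair_opsqrt cX X)
  moreover have "R (R f) = C f" for f
  proof -
    have "R (R f) = (sqrt t * sqrt t) *\<^sub>R opsqrt X (opsqrt X f)"
      by (simp add: R_def linear_scale[OF linE])
    also have "\<dots> = C f" unfolding opsqrt_square[OF cX] using t(1) by (simp add: X_def)
    finally show ?thesis .
  qed
  moreover have "T (R f) = R (T f)" if T: "bounded_linear T" "\<And>f. T (C f) = C (T f)" for T f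
  proof -
    note linT = bounded_linear.linear[OF T(1)]
    have "T (opsqrt X f) = opsqrt X (T f)"
      by (rule opsqrt_intertwine[OF cX cX T(1)])
        (simp add: X_def linear_diff[OF linT] linear_scale[OF linT] T(2))
    then show ?thesis by (simp add: R_def linear_scale[OF linT])
  qed
  ultimately show ?thesis by (rule that)
qed

text \<open>Polarization. The defect B vanishes on the diagonal because positive elements are
  self-adjoint; f + g shows that B is antisymmetric, and replacing f by \<open>act imag f\<close>
  that it is symmetric.\<close>

lemma positive_operator_selfadjoint:
  assumes "adjointable ip C" and pos: "\<And>f. ca_pos (ip (C f) f)"
  shows "adj_pair C C"
proof -
  obtain C' where C: "adj_pair C C'" using assms(1) by (auto simp: adjointable_iff_adj_pair)
  have add: "C (f + g) = C f + C g" for f g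
    by (rule linear_add[OF bounded_linear.linear[OF adj_pair_bounded_linear[OF C]]])
  have act: "C (act a f) = act a (C f)" for a f
    by (rule ip_left_cong) (simp add: adj_pairD[OF C] ip_act_left)
  define B where "B f g = ip (C f) g - ip f (C g)" for f g
  have B0: "B f f = 0" for f
    using ca_pos_selfadjoint[OF pos[of f]] by (simp add: B_def ip_commute[of f "C f"])
  have swap: "B f g + B g f = 0" for f g
    using B0[of "f + g"] B0[of f] B0[of g] by (simp add: B_def add ip_simps algebra_simps)
  have "B f g = 0" for f g
  proof -
    have "B (act imag f) g = imag * B f g" "B g (act imag f) = - (imag * B g f)"
      by (simp_all add: B_def act ip_simps right_diff_distrib imag_central)
    then have "imag * (B f g - B g f) = 0"
      using swap[of "act imag f" g] by (simp add: right_diff_distrib)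
    then have "imag * (imag * (B f g - B g f)) = 0" by simp
    then have "B f g = B g f" by simp
    then have "2 *\<^sub>R B f g = 0" using swap[of f g] by (simp add: scaleR_2)
    then show ?thesis by simp
  qed
  then show ?thesis by (simp add: B_def adj_pair_def)
qed

text \<open>g minus its projection is orthogonal to W. This turns each frame sum into a value of
  \<open>ip (S f) g\<close>.\<close>

lemma ip_orth_proj:
  assumes W: "orth_compl_submodule act ip W"
  shows "ip (orth_proj ip W f) (orth_proj ip W g) = ip (orth_proj ip W f) g"
proof -
  have proj: "orth_proj ip W f \<in> W \<and> (\<forall>x\<in>W. ip (f - orth_proj ip W f) x = 0)" for f
    unfolding orth_proj_def
  proof (rule theI')
    obtain u v where u: "u \<in> W" "f = u + v" "\<forall>x\<in>W. ip v x = 0"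
      using W unfolding orth_compl_submodule_def by blast
    show "\<exists>!u. u \<in> W \<and> (\<forall>x\<in>W. ip (f - u) x = 0)"
    proof (rule ex1I[of _ u])
      show "u \<in> W \<and> (\<forall>x\<in>W. ip (f - u) x = 0)" using u by simp
      fix u' assume u': "u' \<in> W \<and> (\<forall>x\<in>W. ip (f - u') x = 0)"
      have "act (of_real (-1)) u \<in> W" using W u unfolding orth_compl_submodule_def by blast
      then have "u' + (-1) *\<^sub>R u \<in> W" using W u' unfolding orth_compl_submodule_def act_of_real by blast
      then have d: "u' - u \<in> W" by simp
      have "ip (u' - u) (u' - u) = ip (f - u) (u' - u) - ip (f - u') (u' - u)"
        by (simp flip: ip_diff_left)
      also have "\<dots> = 0" using d u u' by simp
      finally show "u' = u" using ip_self_eq_0 by fastforce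
    qed
  qed
  have "ip (g - orth_proj ip W g) (orth_proj ip W f) = 0" using proj by blast
  then have "ip (orth_proj ip W f) (g - orth_proj ip W g) = 0"
    by (subst ip_commute) simp
  then show ?thesis by (simp add: ip_diff_right)
qed

end

section \<open>Transport of frame bounds\<close>

lemma strictly_nonzero_scaleR:
  assumes "strictly_nonzero A" "r \<noteq> 0"
  shows "strictly_nonzero (r *\<^sub>R A)"
proof -
  have eq: "strictly_nonzero a \<longleftrightarrow> ca_invertible a" for a :: 'a
    by (simp add: strictly_nonzero_def ca_spectrum_def cscale_def)
  obtain B where "A * B = 1" "B * A = 1" using assms by (auto simp: eq ca_invertible_def)
  then have "(r *\<^sub>R A) * (inverse r *\<^sub>R B) = 1" "(inverse r *\<^sub>R B) * (r *\<^sub>R A) = 1"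
    using assms(2) by auto
  then show ?thesis unfolding eq ca_invertible_def by blast
qed

context hilbert_mod
begin

text \<open>Both frame inequalities have this shape with L the adjoint of K; their forms Q differ by
  substituting V f for f.\<close>

definition frame_bounds :: "('h \<Rightarrow> 'h) \<Rightarrow> ('h \<Rightarrow> 'a) \<Rightarrow> bool" where
  "frame_bounds L Q \<longleftrightarrow> (\<exists>A B. strictly_nonzero A \<and> strictly_nonzero B \<and>
     (\<forall>f. ca_le (A * ip (L f) (L f) * cstar A) (Q f) \<and> ca_le (Q f) (B * ip f f * cstar B)))"

text \<open>The upper bound uses the estimate for V. For the lower one, the estimate for the left
  inverse G at V (L f) bounds \<open>ip (L f) (L f)\<close> by N times
  \<open>ip (V (L f)) (V (L f))\<close>, and V (L f) = L (V f) brings in the old lower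
  bound.\<close>

lemma frame_bounds_transform:
  assumes "frame_bounds L Q" and V: "adj_pair V V'" and G: "adj_pair G G'"
    and GV: "\<And>f. G (V f) = f" and LV: "\<And>f. L (V f) = V (L f)"
  shows "frame_bounds L (\<lambda>f. Q (V f))"
proof -
  obtain A B where AB: "strictly_nonzero A" "strictly_nonzero B"
    and lower: "\<And>f. ca_le (A * ip (L f) (L f) * cstar A) (Q f)"
    and upper: "\<And>f. ca_le (Q f) (B * ip f f * cstar B)"
    using assms(1) unfolding frame_bounds_def by blast
  obtain M where M: "M > 0" "\<And>f. ca_le (ip (V f) (V f)) (M *\<^sub>R ip f f)"
    using adj_pair_ip_bound[OF V] by blast
  obtain N where N: "N > 0" "\<And>f. ca_le (ip (G f) (G f)) (N *\<^sub>R ip f f)"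
    using adj_pair_ip_bound[OF G] by blast
  \<comment> \<open>\<open>A'\<close> and \<open>cstar A'\<close> each contribute one scalar factor,
    hence square roots.\<close>
  define A' where "A' = inverse (sqrt N) *\<^sub>R A"
  define B' where "B' = sqrt M *\<^sub>R B"
  have "ca_le (A' * ip (L f) (L f) * cstar A') (Q (V f))" for f
  proof -
    have "ca_le (ip (L f) (L f)) (N *\<^sub>R ip (V (L f)) (V (L f)))"
      using N(2)[of "V (L f)"] by (simp add: GV)
    then have "ca_le (inverse N *\<^sub>R ip (L f) (L f)) (ip (V (L f)) (V (L f)))"
      using ca_le_scaleR[of _ _ "inverse N"] N(1) by fastforce
    from ca_le_conjugate[OF this, of A]
    have "ca_le (A' * ip (L f) (L f) * cstar A') (A * ip (L (V f)) (L (V f)) * cstar A)"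
      using N(1) by (simp add: A'_def LV flip: inverse_mult_distrib)
    from ca_le_trans[OF this lower] show ?thesis .
  qed
  moreover have "ca_le (Q (V f)) (B' * ip f f * cstar B')" for f
  proof -
    have "B * (M *\<^sub>R ip f f) * cstar B = B' * ip f f * cstar B'"
      using M(1) by (simp add: B'_def)
    then show ?thesis
      using ca_le_trans[OF upper ca_le_conjugate[OF M(2)]] by metis
  qed
  moreover have "strictly_nonzero A'" "strictly_nonzero B'"
    unfolding A'_def B'_def using AB M(1) N(1) by (auto intro!: strictly_nonzero_scaleR)
  ultimately show ?thesis unfolding frame_bounds_def by blast
qed

end

section \<open>Equivalence of the two frame conditions\<close>

theorem mainTheorem13:
  fixes act :: "'a::cstar_algebra \<Rightarrow> 'h::banach \<Rightarrow> 'h"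
    and ip :: "'h \<Rightarrow> 'h \<Rightarrow> 'a"
    and K C C' S :: "'h \<Rightarrow> 'h"
    and I :: "'i set" and W :: "'i \<Rightarrow> 'h set" and w :: "'i \<Rightarrow> 'a"
  assumes "hilbert_module act ip"
    and "adjointable ip K"
    and "GLplus ip C" and "GLplus ip C'"
    and "C \<circ> C' = C' \<circ> C"
    and "\<forall>i\<in>I. orth_compl_submodule act ip (W i)"
    and "\<forall>i\<in>I. weight (w i)"
    and "\<forall>f. (\<lambda>i. act (w i * w i) (orth_proj ip (W i) f)) summable_on I"
    and "S = (\<lambda>f. \<Sum>\<^sub>\<infinity>i\<in>I. act (w i * w i) (orth_proj ip (W i) f))"
    and "K \<circ> C = C \<circ> K" and "K \<circ> C' = C' \<circ> K"
    and "S \<circ> C = C \<circ> S" and "S \<circ> C' = C' \<circ> S"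
  shows "star_K_fusion_frame ip K I W w \<longleftrightarrow> controlled_star_K_fusion_frame ip K C C' I W w"
proof -
  interpret hilbert_mod act ip by unfold_locales (rule assms(1))
  let ?p = "\<lambda>i. orth_proj ip (W i)"
  have comm: "K (C f) = C (K f)" "K (C' f) = C' (K f)" "S (C f) = C (S f)" "S (C' f) = C' (S f)"
    "C (C' f) = C' (C f)" for f
    using assms(5,10-13) by (auto simp: fun_eq_iff)
  \<comment> \<open>A polarized form of both frame sums: f = g is the uncontrolled case, the
    arguments C f and C' f the controlled one. It also settles convergence in both
    definitions.\<close>
  have S_sum: "((\<lambda>i. w i * w i * ip (?p i f) (?p i g)) has_sum ip (S f) g) I" for f g
  proof -
    have "((\<lambda>i. act (w i * w i) (?p i f)) has_sum S f) I"
      unfolding assms(9) using assms(8) by (intro has_sum_infsum) blast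
    from has_sum_bounded_linear[OF bounded_linear_ip_left this, of g]
    have "((\<lambda>i. w i * w i * ip (?p i f) g) has_sum ip (S f) g) I"
      by (simp add: ip_act_left)
    moreover have "ip (?p i f) g = ip (?p i f) (?p i g)" if "i \<in> I" for i
      using ip_orth_proj assms(6) that by metis
    ultimately show ?thesis
      using has_sum_cong[of I "\<lambda>i. w i * w i * ip (?p i f) g"] by simp
  qed
  have S: "adj_pair S S"
    unfolding adj_pair_def
  proof safe
    fix f g
    \<comment> \<open>Weights are self-adjoint and central, so \<open>cstar\<close> merely exchanges
      f and g.\<close>
    have "cstar (w i * w i * ip (?p i g) (?p i f)) = w i * w i * ip (?p i f) (?p i g)" if "i \<in> I" for i
    proof -
      have w: "w i * x = x * w i" "cstar (w i) = w i" for x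
        using assms(7) that ca_pos_selfadjoint by (auto simp: weight_def)
      have "w i * w i * x = x * (w i * w i)" for x by (metis w(1) mult.assoc)
      then show ?thesis by (simp add: w(2) flip: ip_commute)
    qed
    then have "((\<lambda>i. w i * w i * ip (?p i f) (?p i g)) has_sum cstar (ip (S g) f)) I"
      using has_sum_bounded_linear[OF bounded_linear_cstar S_sum[of g f]]
        has_sum_cong[of I "\<lambda>i. cstar (w i * w i * ip (?p i g) (?p i f))"] by simp
    then show "ip (S f) g = ip f (S g)"
      using S_sum has_sum_unique ip_commute by metis
  qed
  define L where "L = adjoint ip K"
  have K: "adj_pair K L" unfolding L_def using assms(2) by (rule adj_pair_adjoint)
  have C: "adj_pair C C" "\<And>f. ca_pos (ip (C f) f)" and C': "adj_pair C' C'" "\<And>f. ca_pos (ip (C' f) f)"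
    using assms(3,4) positive_operator_selfadjoint by (auto simp: GLplus_def)
  obtain Ci where Ci: "adjointable ip Ci" "\<And>f. C (Ci f) = f" "\<And>f. Ci (C f) = f"
    using assms(3) by (auto simp: GLplus_def fun_eq_iff)
  obtain Ci' where Ci': "adjointable ip Ci'" "\<And>f. C' (Ci' f) = f" "\<And>f. Ci' (C' f) = f"
    using assms(4) by (auto simp: GLplus_def fun_eq_iff)
  obtain R where R: "adj_pair R R" "\<And>f. R (R f) = C f"
    "\<And>T f. bounded_linear T \<Longrightarrow> (\<And>f. T (C f) = C (T f)) \<Longrightarrow> T (R f) = R (T f)"
    using positive_operator_sqrt[OF C] by blast
  obtain R' where R': "adj_pair R' R'" "\<And>f. R' (R' f) = C' f"
    "\<And>T f. bounded_linear T \<Longrightarrow> (\<And>f. T (C' f) = C' (T f)) \<Longrightarrow> T (R' f) = R' (T f)"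
    using positive_operator_sqrt[OF C'] by blast
  note bl = adj_pair_bounded_linear
  have SR: "S (R f) = R (S f)" "S (R' f) = R' (S f)" "K (R f) = R (K f)" "K (R' f) = R' (K f)" for f
    using R(3)[OF bl[OF S]] R'(3)[OF bl[OF S]] R(3)[OF bl[OF K]] R'(3)[OF bl[OF K]] comm by auto
  \<comment> \<open>Commutation passes from C to its root R, then from C' to R'.\<close>
  have "C' (R f) = R (C' f)" for f using R(3)[OF bl[OF C'(1)]] comm by auto
  then have RR': "R (R' f) = R' (R f)" for f using R'(3)[OF bl[OF R(1)]] by simp
  define V where "V f = R (R' f)" for f
  have V: "adj_pair V V"
    using adj_pair_comp[OF R(1) R'(1)] RR' by (simp add: adj_pair_def V_def)
  have VV: "V (V f) = C (C' f)" for f by (simp add: V_def R(2) R'(2) flip: RR')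
  have KV: "K (V f) = V (K f)" for f by (simp add: V_def SR)
  \<comment> \<open>Taking adjoints in KV = VK, with V self-adjoint.\<close>
  have LV: "L (V f) = V (L f)" for f
    by (rule ip_right_cong) (simp add: KV flip: adj_pairD[OF K] adj_pairD[OF V])
  obtain Di Di' where "adj_pair Ci Di" "adj_pair Ci' Di'"
    using Ci(1) Ci'(1) by (auto simp: adjointable_iff_adj_pair)
  \<comment> \<open>As V^2 = CC', this is the inverse of V, in a form whose adjoint is
    explicit.\<close>
  define G where "G f = Ci' (Ci (V f))" for f
  have G: "adj_pair G (\<lambda>f. V (Di (Di' f)))"
    unfolding G_def
    using adj_pair_comp[OF \<open>adj_pair Ci' Di'\<close> adj_pair_comp[OF \<open>adj_pair Ci Di\<close> V]] by simp
  have GV: "G (V f) = f" for f by (simp add: G_def VV Ci(3) Ci'(3))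
  have VG: "V (G f) = f" for f
  proof -
    \<comment> \<open>V is onto, so its left inverse G is also a right inverse.\<close>
    have "f = V (V (Ci' (Ci f)))" by (simp add: VV Ci(2) Ci'(2))
    then show ?thesis by (metis GV)
  qed
  have LG: "L (G f) = G (L f)" for f by (metis GV VG LV)
  define Q where "Q f = ip (S f) f" for f
  have "ip (S (C f)) (C' f) = Q (V f)" for f
  proof -
    \<comment> \<open>One R' moves to the left and one R to the right; commuting them past S leaves
      V f on both sides.\<close>
    have "ip (S (C f)) (C' f) = ip (S (R (R f))) (R' (R' f))" by (simp add: R(2) R'(2))
    also have "\<dots> = ip (R' (R (S (R f)))) (R' f)" by (simp add: adj_pairD[OF R'(1)] SR)
    also have "\<dots> = ip (R (S (V f))) (R' f)" by (simp add: V_def SR flip: RR')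
    also have "\<dots> = Q (V f)" by (simp add: Q_def V_def adj_pairD[OF R(1)])
    finally show ?thesis .
  qed
  then have ctrl: "controlled_star_K_fusion_frame ip K C C' I W w \<longleftrightarrow> frame_bounds L (\<lambda>f. Q (V f))"
    unfolding controlled_star_K_fusion_frame_def frame_bounds_def infsumI[OF S_sum] L_def
    using S_sum by (auto simp: summable_on_def)
  have "star_K_fusion_frame ip K I W w \<longleftrightarrow> frame_bounds L Q"
    unfolding star_K_fusion_frame_def controlled_star_K_fusion_frame_def frame_bounds_def
      infsumI[OF S_sum] L_def Q_def id_apply
    using S_sum by (auto simp: summable_on_def)
  also have "\<dots> \<longleftrightarrow> frame_bounds L (\<lambda>f. Q (V f))"
  proof
    assume "frame_bounds L Q"
    from frame_bounds_transform[OF this V G GV LV] show "frame_bounds L (\<lambda>f. Q (V f))" .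
  next
    assume "frame_bounds L (\<lambda>f. Q (V f))"
    \<comment> \<open>V and G exchange roles, and Q (V (G f)) = Q f.\<close>
    from frame_bounds_transform[OF this G V VG LG] show "frame_bounds L Q" by (simp add: VG)
  qed
  finally show ?thesis unfolding ctrl .
qed

end
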